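(* Let $K_m^-$ and $K_n^-$ be antibalanced signed complete graphs of order $m$ and $n$ respectively, and let $K_m^-\Box K_n^-$ be their Cartesian product. Then $$\operatorname{bdim}(K_m^-\Box K_n^-)=\begin{cases}\bar\nu(m), & \text{if } m\geq n,\\ \bar\nu(n), & \text{if } m\leq n,\end{cases}$$ where $\bar\nu(m)=\operatorname{bdim}(K_m^-)$.
   Context: A signed graph $\Sigma=(G,\sigma)$ is a graph $G=(V,E)$ with a function $\sigma:E\to\{+1,-1\}$. The sign of a cycle is the product of the signs of its edges; $\Sigma$ is balanced if it has no cycle of sign $-1$, and antibalanced if $-\Sigma=(G,-\sigma)$ is balanced. Let $\Omega=\{-1,0,1\}$, with $\Omega^k\subset\mathbb{R}^k$ carrying the standard inner product $\langle\cdot,\cdot\rangle$. A vector valued switching function ($k$-switching function) for $\Sigma$ is a map $\zeta:V\to\Omega^k$ with $\langle\zeta(u),\zeta(v)\rangle\neq 0$ for every edge $uv\in E$; the switched signed graph $\Sigma^\zeta=(G,\sigma^\zeta)$ has $\sigma^\zeta(uv)=\sigma(uv)\operatorname{sgn}(\langle\zeta(u),\zeta(v)\rangle)$. The balancing dimension $\operatorname{bdim}(\Sigma)$ is the least integer $k\ge 1$ for which there is a $k$-switching function $\zeta:V\to\Omega^k$ such that $\Sigma^\zeta$ is all-positive (every edge has sign $+1$). $K_n^-$ denotes an antibalanced signed graph whose underlying graph is the complete graph $K_n$, and $\bar\nu(n)=\operatorname{bdim}(K_n^-)$. (This does not depend on the choice of antibalanced signature: all antibalanced signatures on $K_n$ are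 equivalent under ordinary $\{\pm1\}$-switching, which preserves $\operatorname{bdim}$.) The Cartesian product $\Sigma_1\Box\Sigma_2$ of $\Sigma_1=(G_1,\sigma_1)$ and $\Sigma_2=(G_2,\sigma_2)$ is the Cartesian product $G_1\Box G_2$ of the underlying graphs, with signature $\sigma((u_i,v_j)(u_k,v_l))=\sigma_1(u_iu_k)$ if $j=l$, and $=\sigma_2(v_jv_l)$ if $i=k$. *)

theory Defs
  imports "Jordan_Normal_Form.Matrix"
begin

section \<open>Signed graphs\<close>

text \<open>
  Graphs are finite and simple. An edge \<open>uv\<close> is given by a symmetric adjacency relation, and the
  signature by a function of the two end vertices that is symmetric on edges; its values on
  non-adjacent pairs are irrelevant.
\<close>

record 'a sgraph =
  verts :: "'a set"
  adj :: "'a \<Rightarrow> 'a \<Rightarrow> bool"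
  sig :: "'a \<Rightarrow> 'a \<Rightarrow> real"

definition signed_graph :: "'a sgraph \<Rightarrow> bool" where
  "signed_graph \<Sigma> \<longleftrightarrow>
     finite (verts \<Sigma>) \<and>
     (\<forall>u v. adj \<Sigma> u v \<longrightarrow> u \<in> verts \<Sigma> \<and> v \<in> verts \<Sigma> \<and> u \<noteq> v \<and> adj \<Sigma> v u) \<and>
     (\<forall>u v. adj \<Sigma> u v \<longrightarrow> sig \<Sigma> u v \<in> {1, -1} \<and> sig \<Sigma> u v = sig \<Sigma> v u)"

definition complete :: "'a sgraph \<Rightarrow> bool" where
  "complete \<Sigma> \<longleftrightarrow> (\<forall>u\<in>verts \<Sigma>. \<forall>v\<in>verts \<Sigma>. u \<noteq> v \<longrightarrow> adj \<Sigma> u v)"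

definition all_positive :: "'a sgraph \<Rightarrow> bool" where
  "all_positive \<Sigma> \<longleftrightarrow> (\<forall>u v. adj \<Sigma> u v \<longrightarrow> sig \<Sigma> u v = 1)"

definition neg :: "'a sgraph \<Rightarrow> 'a sgraph" where
  "neg \<Sigma> = \<Sigma>\<lparr>sig := \<lambda>u v. - sig \<Sigma> u v\<rparr>"

text \<open>A cycle is given by the list of its distinct vertices in cyclic order.\<close>

definition is_cycle :: "'a sgraph \<Rightarrow> 'a list \<Rightarrow> bool" where
  "is_cycle \<Sigma> vs \<longleftrightarrow> 3 \<le> length vs \<and> distinct vs \<and>
     (\<forall>i<length vs. adj \<Sigma> (vs ! i) (vs ! (Suc i mod length vs)))"

definition cycle_sign :: "'a sgraph \<Rightarrow> 'a list \<Rightarrow> real" where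
  "cycle_sign \<Sigma> vs = (\<Prod>i<length vs. sig \<Sigma> (vs ! i) (vs ! (Suc i mod length vs)))"

definition balanced :: "'a sgraph \<Rightarrow> bool" where
  "balanced \<Sigma> \<longleftrightarrow> \<not> (\<exists>vs. is_cycle \<Sigma> vs \<and> cycle_sign \<Sigma> vs = -1)"

definition antibalanced :: "'a sgraph \<Rightarrow> bool" where
  "antibalanced \<Sigma> \<longleftrightarrow> balanced (neg \<Sigma>)"

definition cart_prod :: "'a sgraph \<Rightarrow> 'b sgraph \<Rightarrow> ('a \<times> 'b) sgraph" (infixl "\<box>" 70) where
  "\<Sigma>\<^sub>1 \<box> \<Sigma>\<^sub>2 =
     \<lparr> verts = verts \<Sigma>\<^sub>1 \<times> verts \<Sigma>\<^sub>2,
       adj = (\<lambda>(u, v) (u', v').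
         (adj \<Sigma>\<^sub>1 u u' \<and> v = v' \<and> v \<in> verts \<Sigma>\<^sub>2) \<or> (u = u' \<and> u \<in> verts \<Sigma>\<^sub>1 \<and> adj \<Sigma>\<^sub>2 v v')),
       sig = (\<lambda>(u, v) (u', v'). if v = v' then sig \<Sigma>\<^sub>1 u u' else sig \<Sigma>\<^sub>2 v v') \<rparr>"


section \<open>Vector valued switching and the balancing dimension\<close>

definition Omega_vec :: "nat \<Rightarrow> real vec set" where
  "Omega_vec k = {x \<in> carrier_vec k. \<forall>i<k. x $ i \<in> {-1, 0, 1}}"

definition switching_fun :: "nat \<Rightarrow> 'a sgraph \<Rightarrow> ('a \<Rightarrow> real vec) \<Rightarrow> bool" where
  "switching_fun k \<Sigma> \<zeta> \<longleftrightarrow>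
     (\<forall>v\<in>verts \<Sigma>. \<zeta> v \<in> Omega_vec k) \<and> (\<forall>u v. adj \<Sigma> u v \<longrightarrow> \<zeta> u \<bullet> \<zeta> v \<noteq> 0)"

definition switch :: "'a sgraph \<Rightarrow> ('a \<Rightarrow> real vec) \<Rightarrow> 'a sgraph" where
  "switch \<Sigma> \<zeta> = \<Sigma>\<lparr>sig := \<lambda>u v. sig \<Sigma> u v * sgn (\<zeta> u \<bullet> \<zeta> v)\<rparr>"

definition bdim :: "'a sgraph \<Rightarrow> nat" where
  "bdim \<Sigma> = (LEAST k. 1 \<le> k \<and> (\<exists>\<zeta>. switching_fun k \<Sigma> \<zeta> \<and> all_positive (switch \<Sigma> \<zeta>)))"

text \<open>The minimum above is attained, so \<open>LEAST\<close> is never underspecified.\<close>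

lemma bdim_exists:
  assumes "signed_graph \<Sigma>"
  shows "\<exists>k\<ge>1. \<exists>\<zeta>. switching_fun k \<Sigma> \<zeta> \<and> all_positive (switch \<Sigma> \<zeta>)"
proof -
  define S where "S = {{u, v} | u v. adj \<Sigma> u v}"
  have "S \<subseteq> Pow (verts \<Sigma>)"
    using assms by (auto simp: S_def signed_graph_def)
  hence "finite S"
    using assms unfolding signed_graph_def by (metis finite_Pow_iff finite_subset)
  then obtain es where es: "set es = S" "distinct es"
    using finite_distinct_list by blast
  define h where "h = (\<lambda>e::'a set. SOME u. u \<in> e)"
  define t where "t = (\<lambda>e u. if u \<notin> e then 0 else if u = h e then 1
                     else sig \<Sigma> (h e) u)"
  have edge: "\<exists>u v. e = {u, v} \<and> adj \<Sigma> u v \<and> h e = u" if e: "e \<in> S" for e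
  proof -
    obtain u v where uv: "e = {u, v}" "adj \<Sigma> u v" using e unfolding S_def by blast
    have "h e \<in> e" using uv unfolding h_def by (metis insertI1 someI_ex)
    thus ?thesis using uv assms unfolding signed_graph_def by blast
  qed
  have tval: "t e u \<in> {-1, 0, 1}" if "e \<in> S" for e u
    using edge[OF that] assms unfolding t_def signed_graph_def by fastforce
  have tprod: "t e u * t e v = (if e = {u, v} then sig \<Sigma> u v else 0)"
    if e: "e \<in> S" and uv: "adj \<Sigma> u v" for e u v
  proof (cases "e = {u, v}")
    case True
    from edge[OF e] have "h e = u \<or> h e = v" using True by blast
    moreover have "u \<noteq> v" "sig \<Sigma> u v = sig \<Sigma> v u" using uv assms by (auto simp: signed_graph_def)
    ultimately show ?thesis using True by (auto simp: t_def)
  next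
    case False
    have "u \<noteq> v" using uv assms by (auto simp: signed_graph_def)
    obtain a b where "e = {a, b}" using edge[OF e] by blast
    with False \<open>u \<noteq> v\<close> have "u \<notin> e \<or> v \<notin> e" by auto
    thus ?thesis using False by (auto simp: t_def)
  qed
  define k where "k = Suc (length es)"
  define \<zeta> where "\<zeta> = (\<lambda>u. vec k (\<lambda>i. if i < length es then t (es ! i) u else 0))"
  have ip: "\<zeta> u \<bullet> \<zeta> v = sig \<Sigma> u v" if uv: "adj \<Sigma> u v" for u v
  proof -
    have "{u, v} \<in> S" using uv unfolding S_def by blast
    then obtain j where j: "j < length es" "es ! j = {u, v}"
      using es by (metis in_set_conv_nth)
    have "\<zeta> u \<bullet> \<zeta> v = (\<Sum>i<length es. t (es ! i) u * t (es ! i) v)"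
      by (simp add: scalar_prod_def \<zeta>_def k_def lessThan_atLeast0)
    also have "\<dots> = (\<Sum>i<length es. if i = j then sig \<Sigma> u v else 0)"
    proof (rule sum.cong)
      fix i assume "i \<in> {..<length es}"
      hence i: "i < length es" by simp
      have "es ! i = {u, v} \<longleftrightarrow> i = j" using i j es(2) by (metis nth_eq_iff_index_eq)
      thus "t (es ! i) u * t (es ! i) v = (if i = j then sig \<Sigma> u v else 0)"
        using tprod[OF _ uv, of "es ! i"] i es(1) by (metis nth_mem)
    qed simp
    finally show ?thesis using j by simp
  qed
  have "\<zeta> u \<in> Omega_vec k" for u
  proof -
    have "t (es ! i) u \<in> {-1, 0, 1}" if "i < length es" for i
      using tval es(1) nth_mem[OF that] by metis
    thus ?thesis by (simp add: Omega_vec_def \<zeta>_def)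
  qed
  moreover have "sig \<Sigma> u v = 1 \<or> sig \<Sigma> u v = -1" if "adj \<Sigma> u v" for u v
    using that assms by (auto simp: signed_graph_def)
  ultimately have "switching_fun k \<Sigma> \<zeta> \<and> all_positive (switch \<Sigma> \<zeta>)"
    by (fastforce simp: switching_fun_def all_positive_def switch_def ip)
  thus ?thesis by (intro exI[of _ k]) (auto simp: k_def)
qed


section \<open>Antibalanced complete graphs\<close>

definition antibalanced_complete :: "nat \<Rightarrow> 'a sgraph \<Rightarrow> bool" where
  "antibalanced_complete n \<Sigma> \<longleftrightarrow>
     signed_graph \<Sigma> \<and> complete \<Sigma> \<and> card (verts \<Sigma>) = n \<and> antibalanced \<Sigma>"

definition neg_complete :: "nat \<Rightarrow> nat sgraph" where
  "neg_complete n =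
     \<lparr> verts = {..<n}, adj = (\<lambda>u v. u < n \<and> v < n \<and> u \<noteq> v), sig = (\<lambda>u v. -1) \<rparr>"

text \<open>
  \<open>nubar n\<close> is defined from the all-negative \<open>K\<^sub>n\<close>; lemma \<open>nubar_eq_bdim\<close> shows that any other
  antibalanced signed complete graph of order \<open>n\<close>, on any vertex type, gives the same value.
\<close>

definition nubar :: "nat \<Rightarrow> nat" where
  "nubar n = bdim (neg_complete n)"

lemma antibalanced_complete_neg_complete: "antibalanced_complete n (neg_complete n)"
  by (auto simp: antibalanced_complete_def neg_complete_def signed_graph_def complete_def
      antibalanced_def balanced_def neg_def cycle_sign_def)

lemma antibalanced_complete_switchable_iff:
  assumes A: "antibalanced_complete n \<Sigma>"
  shows "(\<exists>\<zeta>. switching_fun k \<Sigma> \<zeta> \<and> all_positive (switch \<Sigma> \<zeta>)) \<longleftrightarrow>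
    (\<exists>\<eta>. (\<forall>v\<in>verts \<Sigma>. \<eta> v \<in> Omega_vec k) \<and>
         (\<forall>u\<in>verts \<Sigma>. \<forall>v\<in>verts \<Sigma>. u \<noteq> v \<longrightarrow> \<eta> u \<bullet> \<eta> v < 0))"
    (is "?L \<longleftrightarrow> ?R")
proof (cases "verts \<Sigma> = {}")
  case True
  then show ?thesis
    using A by (auto simp: antibalanced_complete_def signed_graph_def switching_fun_def
        all_positive_def switch_def)
next
  case False
  then obtain r where r: "r \<in> verts \<Sigma>" by blast
  have adj_iff: "adj \<Sigma> u v \<longleftrightarrow> u \<in> verts \<Sigma> \<and> v \<in> verts \<Sigma> \<and> u \<noteq> v" for u v
    using A unfolding antibalanced_complete_def signed_graph_def complete_def by blast
  have sgn1: "sig \<Sigma> u v \<in> {1, -1}" and sgn_sym: "sig \<Sigma> u v = sig \<Sigma> v u" if "adj \<Sigma> u v" for u v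
    using A that unfolding antibalanced_complete_def signed_graph_def by blast+
  define f where "f = (\<lambda>u. if u = r then 1 else - sig \<Sigma> r u)"
  have f1: "f u \<in> {1, -1}" if "u \<in> verts \<Sigma>" for u
    using sgn1[of r u] r that by (auto simp: f_def adj_iff)
  have sf: "sig \<Sigma> u v = - f u * f v" if uv: "adj \<Sigma> u v" for u v
  proof (cases "u = r \<or> v = r")
    case True
    then show ?thesis using uv sgn_sym[OF uv] by (auto simp: f_def adj_iff)
  next
    case False
    have adjs: "adj \<Sigma> r u" "adj \<Sigma> v r" using False uv r by (auto simp: adj_iff)
    have "adj \<Sigma> ([r, u, v] ! i) ([r, u, v] ! (Suc i mod 3))" if "i < 3" for i
    proof -
      from that consider "i = 0" | "i = 1" | "i = 2" by linarith
      thus ?thesis using uv adjs by cases simp_all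
    qed
    hence "is_cycle (neg \<Sigma>) [r, u, v]"
      using False uv by (auto simp: is_cycle_def neg_def adj_iff)
    hence "cycle_sign (neg \<Sigma>) [r, u, v] \<noteq> -1"
      using A by (auto simp: antibalanced_complete_def antibalanced_def balanced_def)
    moreover have "cycle_sign (neg \<Sigma>) [r, u, v] = - (sig \<Sigma> r u * sig \<Sigma> u v * sig \<Sigma> v r)"
      by (simp add: cycle_sign_def neg_def lessThan_Suc)
    ultimately have "- (sig \<Sigma> r u * sig \<Sigma> u v * sig \<Sigma> v r) \<noteq> -1" by simp
    then show ?thesis
      using sgn1[OF uv] sgn1[OF adjs(1)] sgn1[OF adjs(2)] sgn_sym[OF adjs(2)] False
      by (auto simp: f_def)
  qed
  have smO: "f u \<cdot>\<^sub>v x \<in> Omega_vec k" if "u \<in> verts \<Sigma>" "x \<in> Omega_vec k" for u x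
    using f1[OF that(1)] that(2) by (fastforce simp: Omega_vec_def)
  have ip: "(f u \<cdot>\<^sub>v x) \<bullet> (f v \<cdot>\<^sub>v y) = f u * f v * (x \<bullet> y)"
    if "x \<in> Omega_vec k" "y \<in> Omega_vec k" for u v x y
  proof -
    have "x \<in> carrier_vec k" "y \<in> carrier_vec k" using that by (auto simp: Omega_vec_def)
    thus ?thesis by simp
  qed
  show ?thesis
  proof
    assume ?L
    then obtain \<zeta> where z: "switching_fun k \<Sigma> \<zeta>" "all_positive (switch \<Sigma> \<zeta>)" by blast
    show ?R
    proof (rule exI[of _ "\<lambda>u. f u \<cdot>\<^sub>v \<zeta> u"], intro conjI ballI impI)
      fix v assume "v \<in> verts \<Sigma>"
      thus "f v \<cdot>\<^sub>v \<zeta> v \<in> Omega_vec k" using z smO by (auto simp: switching_fun_def)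
    next
      fix u v assume uv: "u \<in> verts \<Sigma>" "v \<in> verts \<Sigma>" "u \<noteq> v"
      have "- f u * f v * sgn (\<zeta> u \<bullet> \<zeta> v) = 1"
      proof -
        have a: "adj \<Sigma> u v" using uv by (simp add: adj_iff)
        hence "sig \<Sigma> u v * sgn (\<zeta> u \<bullet> \<zeta> v) = 1"
          using z(2) by (simp add: all_positive_def switch_def)
        thus ?thesis unfolding sf[OF a] .
      qed
      hence "f u * f v * (\<zeta> u \<bullet> \<zeta> v) < 0"
        using f1[OF uv(1)] f1[OF uv(2)] by (auto simp: sgn_if split: if_splits)
      thus "(f u \<cdot>\<^sub>v \<zeta> u) \<bullet> (f v \<cdot>\<^sub>v \<zeta> v) < 0"
        using ip z(1) uv by (simp add: switching_fun_def)
    qed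
  next
    assume ?R
    then obtain \<eta> where h: "\<And>v. v \<in> verts \<Sigma> \<Longrightarrow> \<eta> v \<in> Omega_vec k"
      "\<And>u v. u \<in> verts \<Sigma> \<Longrightarrow> v \<in> verts \<Sigma> \<Longrightarrow> u \<noteq> v \<Longrightarrow> \<eta> u \<bullet> \<eta> v < 0" by blast
    let ?z = "\<lambda>u. f u \<cdot>\<^sub>v \<eta> u"
    have "?z u \<bullet> ?z v \<noteq> 0 \<and> sig \<Sigma> u v * sgn (?z u \<bullet> ?z v) = 1" if uv: "adj \<Sigma> u v" for u v
    proof -
      have V: "u \<in> verts \<Sigma>" "v \<in> verts \<Sigma>" "u \<noteq> v" using uv by (auto simp: adj_iff)
      show ?thesis
        using ip[OF h(1)[OF V(1)] h(1)[OF V(2)]] h(2)[OF V] f1[OF V(1)] f1[OF V(2)] sf[OF uv]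
        by (auto simp: sgn_if)
    qed
    hence "switching_fun k \<Sigma> ?z \<and> all_positive (switch \<Sigma> ?z)"
      using smO h(1) by (simp add: switching_fun_def all_positive_def switch_def)
    thus ?L by (rule exI[where x = ?z])
  qed
qed

lemma nubar_eq_bdim:
  assumes A: "antibalanced_complete n \<Sigma>"
  shows "bdim \<Sigma> = nubar n"
proof -
  have "finite (verts \<Sigma>)" "card (verts \<Sigma>) = card {..<n}"
    using A by (auto simp: antibalanced_complete_def signed_graph_def)
  then obtain b where b: "bij_betw b (verts \<Sigma>) {..<n}"
    using finite_same_card_bij by blast
  have V: "verts (neg_complete n) = {..<n}" by (simp add: neg_complete_def)
  have "(\<exists>\<zeta>. switching_fun k \<Sigma> \<zeta> \<and> all_positive (switch \<Sigma> \<zeta>)) \<longleftrightarrow>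
    (\<exists>\<zeta>. switching_fun k (neg_complete n) \<zeta> \<and> all_positive (switch (neg_complete n) \<zeta>))" for k
    unfolding antibalanced_complete_switchable_iff[OF A]
      antibalanced_complete_switchable_iff[OF antibalanced_complete_neg_complete] V
  proof (intro iffI; elim exE conjE)
    fix \<eta> :: "'a \<Rightarrow> real vec"
    assume h: "\<forall>v\<in>verts \<Sigma>. \<eta> v \<in> Omega_vec k"
      "\<forall>u\<in>verts \<Sigma>. \<forall>v\<in>verts \<Sigma>. u \<noteq> v \<longrightarrow> \<eta> u \<bullet> \<eta> v < 0"
    define c where "c = inv_into (verts \<Sigma>) b"
    have "bij_betw c {..<n} (verts \<Sigma>)" unfolding c_def by (rule bij_betw_inv_into[OF b])
    hence "c i \<in> verts \<Sigma>" "i \<noteq> j \<Longrightarrow> j < n \<Longrightarrow> c i \<noteq> c j" if "i < n" for i j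
      using that by (auto simp: bij_betw_def inj_on_def)
    thus "\<exists>\<eta>. (\<forall>v\<in>{..<n}. \<eta> v \<in> Omega_vec k) \<and>
        (\<forall>u\<in>{..<n}. \<forall>v\<in>{..<n}. u \<noteq> v \<longrightarrow> \<eta> u \<bullet> \<eta> v < 0)"
      using h by (intro exI[of _ "\<eta> \<circ> c"]) auto
  next
    fix \<eta> :: "nat \<Rightarrow> real vec"
    assume h: "\<forall>v\<in>{..<n}. \<eta> v \<in> Omega_vec k"
      "\<forall>u\<in>{..<n}. \<forall>v\<in>{..<n}. u \<noteq> v \<longrightarrow> \<eta> u \<bullet> \<eta> v < 0"
    have "b u < n" "u \<noteq> v \<Longrightarrow> v \<in> verts \<Sigma> \<Longrightarrow> b u \<noteq> b v" if "u \<in> verts \<Sigma>" for u v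
      using that b by (auto simp: bij_betw_def inj_on_def)
    thus "\<exists>\<eta>. (\<forall>v\<in>verts \<Sigma>. \<eta> v \<in> Omega_vec k) \<and>
        (\<forall>u\<in>verts \<Sigma>. \<forall>v\<in>verts \<Sigma>. u \<noteq> v \<longrightarrow> \<eta> u \<bullet> \<eta> v < 0)"
      using h by (intro exI[of _ "\<eta> \<circ> b"]) auto
  qed
  thus ?thesis by (simp add: bdim_def nubar_def)
qed

end

(*
  Restricting a switching function of the product to a copy of either factor bounds the
  balancing dimension below by those of both factors. Conversely, let N be the larger order. After
  {1,-1}-switching both factors are all-negative, so N vectors with pairwise negative inner
  products, placed on the m-by-n grid in the pattern (i + j) mod N, serve for the product: two
  distinct cells in the same row or column never carry the same vector.
*)
theory Submission
  imports Defs "HOL-Number_Theory.Cong"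
begin

definition switchable :: "nat \<Rightarrow> 'a sgraph \<Rightarrow> bool" where
  "switchable k \<Sigma> \<longleftrightarrow> (\<exists>\<zeta>. switching_fun k \<Sigma> \<zeta> \<and> all_positive (switch \<Sigma> \<zeta>))"

text \<open>Because \<open>sgn 0 = 0\<close>, a switched sign of 1 already forces a nonzero inner
  product, so one equation per edge captures both conditions on a switching function.\<close>

lemma switchable_iff:
  "switchable k \<Sigma> \<longleftrightarrow> (\<exists>\<zeta>. (\<forall>v\<in>verts \<Sigma>. \<zeta> v \<in> Omega_vec k) \<and>
     (\<forall>u v. adj \<Sigma> u v \<longrightarrow> sig \<Sigma> u v * sgn (\<zeta> u \<bullet> \<zeta> v) = 1))"
proof -
  have nz: "x \<noteq> 0" if "s * sgn x = 1" for s x :: real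
    using that by auto
  show ?thesis
    unfolding switchable_def switching_fun_def all_positive_def switch_def
    by (intro ex_cong1) (auto dest: nz)
qed

lemma bdim_le:
  assumes "1 \<le> k" "switchable k \<Sigma>"
  shows "bdim \<Sigma> \<le> k"
  unfolding bdim_def switchable_def[symmetric] using assms by (intro Least_le) simp

lemma bdim_switchable:
  assumes "1 \<le> k" "switchable k \<Sigma>"
  shows "1 \<le> bdim \<Sigma> \<and> switchable (bdim \<Sigma>) \<Sigma>"
  unfolding bdim_def switchable_def[symmetric]
  by (rule LeastI[of "\<lambda>k. 1 \<le> k \<and> switchable k \<Sigma>" k]) (use assms in simp)

lemma antibalanced_complete_adj_iff:
  assumes "antibalanced_complete n \<Sigma>"
  shows "adj \<Sigma> u v \<longleftrightarrow> u \<in> verts \<Sigma> \<and> v \<in> verts \<Sigma> \<and> u \<noteq> v"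
  using assms unfolding antibalanced_complete_def signed_graph_def complete_def by blast

text \<open>A balanced signature is a product of vertex signs. In the negated graph,
  \<open>f\<close> is read off the star at a root, and triangles through the root settle all other
  edges.\<close>

lemma antibalanced_complete_potential:
  assumes A: "antibalanced_complete n \<Sigma>"
  obtains f where "\<And>u. u \<in> verts \<Sigma> \<Longrightarrow> f u \<in> {1, -1}"
    and "\<And>u v. adj \<Sigma> u v \<Longrightarrow> sig \<Sigma> u v = - (f u * f v)"
proof (cases "verts \<Sigma> = {}")
  case True
  then show ?thesis
    using that[of "\<lambda>_. 1"] by (simp add: antibalanced_complete_adj_iff[OF A])
next
  case False
  then obtain r where r: "r \<in> verts \<Sigma>" by blast
  note adj_iff = antibalanced_complete_adj_iff[OF A]
  have sgn1: "sig \<Sigma> u v \<in> {1, -1}" and sgn_sym: "sig \<Sigma> u v = sig \<Sigma> v u" if "adj \<Sigma> u v" for u v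
    using A that unfolding antibalanced_complete_def signed_graph_def by blast+
  define f where "f = (\<lambda>u. if u = r then 1 else - sig \<Sigma> r u)"
  show ?thesis
  proof (rule that[of f])
    show "f u \<in> {1, -1}" if "u \<in> verts \<Sigma>" for u
      using sgn1[of r u] r that by (auto simp: f_def adj_iff)
  next
    fix u v assume uv: "adj \<Sigma> u v"
    show "sig \<Sigma> u v = - (f u * f v)"
    proof (cases "u = r \<or> v = r")
      case True
      then show ?thesis using uv sgn_sym[OF uv] by (auto simp: f_def adj_iff)
    next
      case False
      have ru: "adj \<Sigma> r u" and vr: "adj \<Sigma> v r" using False uv r by (auto simp: adj_iff)
      have "adj \<Sigma> ([r, u, v] ! i) ([r, u, v] ! (Suc i mod 3))" if "i < 3" for i
      proof -
        from that consider "i = 0" | "i = 1" | "i = 2" by linarith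
        thus ?thesis using uv ru vr by cases simp_all
      qed
      hence "is_cycle (neg \<Sigma>) [r, u, v]"
        using False uv by (auto simp: is_cycle_def neg_def adj_iff)
      hence "cycle_sign (neg \<Sigma>) [r, u, v] \<noteq> -1"
        using A by (auto simp: antibalanced_complete_def antibalanced_def balanced_def)
      \<comment> \<open>Negating three signs flips their product, so the original triangle has
        product -1, which gives the sign of \<open>uv\<close> from those of \<open>ru\<close> and
        \<open>vr\<close>.\<close>
      hence "sig \<Sigma> r u * sig \<Sigma> u v * sig \<Sigma> v r \<noteq> 1"
        by (simp add: cycle_sign_def neg_def lessThan_Suc mult_ac)
      then show ?thesis
        using sgn1[OF uv] sgn1[OF ru] sgn1[OF vr] sgn_sym[OF vr] False
        by (auto simp: f_def)
    qed
  qed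
qed

lemma switchable_cart_prodD1:
  assumes "switchable k (\<Sigma>\<^sub>1 \<box> \<Sigma>\<^sub>2)" "v \<in> verts \<Sigma>\<^sub>2"
  shows "switchable k \<Sigma>\<^sub>1"
proof -
  obtain \<zeta> where "\<forall>p\<in>verts (\<Sigma>\<^sub>1 \<box> \<Sigma>\<^sub>2). \<zeta> p \<in> Omega_vec k"
    and "\<And>p q. adj (\<Sigma>\<^sub>1 \<box> \<Sigma>\<^sub>2) p q \<Longrightarrow> sig (\<Sigma>\<^sub>1 \<box> \<Sigma>\<^sub>2) p q * sgn (\<zeta> p \<bullet> \<zeta> q) = 1"
    using assms(1) unfolding switchable_iff by blast
  from this(1) this(2)[of "(_, v)" "(_, v)"] show ?thesis
    unfolding switchable_iff using assms(2)
    by (intro exI[of _ "\<lambda>u. \<zeta> (u, v)"]) (simp add: cart_prod_def)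
qed

text \<open>The signature of a product first tests whether the second coordinates agree.
  Irreflexivity makes them differ along a copy of the second factor, so that its own sign is the one
  selected.\<close>

lemma switchable_cart_prodD2:
  assumes "switchable k (\<Sigma>\<^sub>1 \<box> \<Sigma>\<^sub>2)" "u \<in> verts \<Sigma>\<^sub>1" and irrefl: "\<And>v. \<not> adj \<Sigma>\<^sub>2 v v"
  shows "switchable k \<Sigma>\<^sub>2"
proof -
  obtain \<zeta> where "\<forall>p\<in>verts (\<Sigma>\<^sub>1 \<box> \<Sigma>\<^sub>2). \<zeta> p \<in> Omega_vec k"
    and "\<And>p q. adj (\<Sigma>\<^sub>1 \<box> \<Sigma>\<^sub>2) p q \<Longrightarrow> sig (\<Sigma>\<^sub>1 \<box> \<Sigma>\<^sub>2) p q * sgn (\<zeta> p \<bullet> \<zeta> q) = 1"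
    using assms(1) unfolding switchable_iff by blast
  note \<zeta> = this(1) this(2)[of "(u, _)" "(u, _)"]
  have "v \<noteq> v'" if "adj \<Sigma>\<^sub>2 v v'" for v v'
    using that irrefl by blast
  with \<zeta> show ?thesis
    unfolding switchable_iff using assms(2)
    by (intro exI[of _ "\<lambda>v. \<zeta> (u, v)"]) (fastforce simp: cart_prod_def)
qed

text \<open>Cancellation in the integers modulo \<open>N\<close>, where residues below
  \<open>N\<close> are congruent only if equal. It makes the grid pattern a Latin rectangle.\<close>

lemma add_mod_left_imp_eq:
  fixes a :: nat
  assumes "i < N" "j < N" "(a + i) mod N = (a + j) mod N"
  shows "i = j"
  using assms cong_add_lcancel_nat[of a i j N] by (simp add: cong_def)

lemma switchable_cart_prod:
  assumes A1: "antibalanced_complete m \<Sigma>\<^sub>1" and A2: "antibalanced_complete n \<Sigma>\<^sub>2"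
    and N: "m \<le> N" "n \<le> N" "0 < N" and sw: "switchable k (neg_complete N)"
  shows "switchable k (\<Sigma>\<^sub>1 \<box> \<Sigma>\<^sub>2)"
proof -
  note adj_iff = antibalanced_complete_adj_iff[OF A1] antibalanced_complete_adj_iff[OF A2]
  obtain \<eta> where \<eta>: "\<And>i. i < N \<Longrightarrow> \<eta> i \<in> Omega_vec k"
    and ip: "\<And>i j. i < N \<Longrightarrow> j < N \<Longrightarrow> i \<noteq> j \<Longrightarrow> \<eta> i \<bullet> \<eta> j < 0"
    using sw unfolding switchable_def
      antibalanced_complete_switchable_iff[OF antibalanced_complete_neg_complete]
    by (auto simp: neg_complete_def)
  have \<eta>c: "\<eta> i \<in> carrier_vec k" if "i < N" for i
    using \<eta>[OF that] by (simp add: Omega_vec_def)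
  obtain f where f: "\<And>u. u \<in> verts \<Sigma>\<^sub>1 \<Longrightarrow> f u \<in> {1, -1}"
    "\<And>u v. adj \<Sigma>\<^sub>1 u v \<Longrightarrow> sig \<Sigma>\<^sub>1 u v = - (f u * f v)"
    using antibalanced_complete_potential[OF A1] by metis
  obtain g where g: "\<And>u. u \<in> verts \<Sigma>\<^sub>2 \<Longrightarrow> g u \<in> {1, -1}"
    "\<And>u v. adj \<Sigma>\<^sub>2 u v \<Longrightarrow> sig \<Sigma>\<^sub>2 u v = - (g u * g v)"
    using antibalanced_complete_potential[OF A2] by metis
  obtain a where a: "bij_betw a (verts \<Sigma>\<^sub>1) {0..<m}"
    using A1 ex_bij_betw_finite_nat[of "verts \<Sigma>\<^sub>1"]
    by (auto simp: antibalanced_complete_def signed_graph_def)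
  obtain b where b: "bij_betw b (verts \<Sigma>\<^sub>2) {0..<n}"
    using A2 ex_bij_betw_finite_nat[of "verts \<Sigma>\<^sub>2"]
    by (auto simp: antibalanced_complete_def signed_graph_def)
  have aN: "a u < N" if "u \<in> verts \<Sigma>\<^sub>1" for u
    using bij_betwE[OF a] that N(1) by fastforce
  have bN: "b v < N" if "v \<in> verts \<Sigma>\<^sub>2" for v
    using bij_betwE[OF b] that N(2) by fastforce
  \<comment> \<open>Cells differing in both coordinates may share an index, but they are not
    adjacent in the product.\<close>
  define c where "c = (\<lambda>u v. (a u + b v) mod N)"
  \<comment> \<open>Positivity of \<open>N\<close> matters here, as
    \<open>x mod 0 = x\<close>.\<close>
  have cN: "c u v < N" for u v using N(3) by (simp add: c_def)
  have c1: "c u v \<noteq> c u' v" if "u \<in> verts \<Sigma>\<^sub>1" "u' \<in> verts \<Sigma>\<^sub>1" "u \<noteq> u'" for u u' v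
    using add_mod_left_imp_eq[of "a u" N "a u'" "b v"] aN that bij_betw_imp_inj_on[OF a]
    by (auto simp: c_def add.commute dest: inj_onD)
  have c2: "c u v \<noteq> c u v'" if "v \<in> verts \<Sigma>\<^sub>2" "v' \<in> verts \<Sigma>\<^sub>2" "v \<noteq> v'" for u v v'
    using add_mod_left_imp_eq[of "b v" N "b v'" "a u"] bN that bij_betw_imp_inj_on[OF b]
    by (auto simp: c_def dest: inj_onD)
  \<comment> \<open>Along an edge of the first factor \<open>g v\<close> occurs squared and drops
    out. The remaining \<open>f u * f u'\<close> cancels against the signature, whose minus sign is
    offset by the negative inner product. The second factor is symmetric.\<close>
  define \<zeta> where "\<zeta> = (\<lambda>(u, v). (f u * g v) \<cdot>\<^sub>v \<eta> (c u v))"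
  have ip\<zeta>: "\<zeta> (u, v) \<bullet> \<zeta> (u', v') = f u * g v * (f u' * g v') * (\<eta> (c u v) \<bullet> \<eta> (c u' v'))"
    for u v u' v'
    using \<eta>c[OF cN[of u v]] \<eta>c[OF cN[of u' v']] by (simp add: \<zeta>_def)
  have "\<zeta> (u, v) \<in> Omega_vec k" if "u \<in> verts \<Sigma>\<^sub>1" "v \<in> verts \<Sigma>\<^sub>2" for u v
    using f(1)[OF that(1)] g(1)[OF that(2)] \<eta>[OF cN[of u v]]
    by (fastforce simp: \<zeta>_def Omega_vec_def)
  moreover have "sig \<Sigma>\<^sub>1 u u' * sgn (\<zeta> (u, v) \<bullet> \<zeta> (u', v)) = 1"
    if "adj \<Sigma>\<^sub>1 u u'" "v \<in> verts \<Sigma>\<^sub>2" for u u' v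
  proof -
    have V: "u \<in> verts \<Sigma>\<^sub>1" "u' \<in> verts \<Sigma>\<^sub>1" "u \<noteq> u'" using that(1) by (auto simp: adj_iff)
    show ?thesis
      using f(1)[OF V(1)] f(1)[OF V(2)] g(1)[OF that(2)] ip[OF cN cN c1[OF V], of v]
      by (auto simp: ip\<zeta> f(2)[OF that(1)])
  qed
  moreover have "sig \<Sigma>\<^sub>2 v v' * sgn (\<zeta> (u, v) \<bullet> \<zeta> (u, v')) = 1"
    if "u \<in> verts \<Sigma>\<^sub>1" "adj \<Sigma>\<^sub>2 v v'" for u v v'
  proof -
    have V: "v \<in> verts \<Sigma>\<^sub>2" "v' \<in> verts \<Sigma>\<^sub>2" "v \<noteq> v'" using that(2) by (auto simp: adj_iff)
    show ?thesis
      using g(1)[OF V(1)] g(1)[OF V(2)] f(1)[OF that(1)] ip[OF cN cN c2[OF V], of u]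
      by (auto simp: ip\<zeta> g(2)[OF that(2)])
  qed
  \<comment> \<open>For edges of the second factor, \<open>adj_iff\<close> supplies the distinct
    second coordinates that make the product signature choose the second sign.\<close>
  ultimately show ?thesis
    unfolding switchable_iff
    by (intro exI[of _ \<zeta>]) (auto simp: cart_prod_def adj_iff)
qed

text \<open>As \<open>max m n\<close> is one of the two orders, the upper bound meets one of the
  lower bounds, and no monotonicity of \<open>nubar\<close> has to be established.\<close>

lemma bdim_cart_prod_antibalanced_complete:
  assumes mn: "1 \<le> m" "1 \<le> n"
    and A1: "antibalanced_complete m \<Sigma>\<^sub>1" and A2: "antibalanced_complete n \<Sigma>\<^sub>2"
  shows "nubar m \<le> bdim (\<Sigma>\<^sub>1 \<box> \<Sigma>\<^sub>2)" "nubar n \<le> bdim (\<Sigma>\<^sub>1 \<box> \<Sigma>\<^sub>2)"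
    "bdim (\<Sigma>\<^sub>1 \<box> \<Sigma>\<^sub>2) \<le> nubar (max m n)"
proof -
  let ?N = "max m n"
  \<comment> \<open>A witness is required before the \<open>LEAST\<close> in \<open>nubar\<close>
    can be known to be attained.\<close>
  have "signed_graph (neg_complete ?N)"
    using antibalanced_complete_neg_complete by (auto simp: antibalanced_complete_def)
  then obtain k where "1 \<le> k" "switchable k (neg_complete ?N)"
    using bdim_exists unfolding switchable_def by blast
  from bdim_switchable[OF this]
  have nu: "1 \<le> nubar ?N" "switchable (nubar ?N) (neg_complete ?N)"
    by (simp_all add: nubar_def)
  have P: "switchable (nubar ?N) (\<Sigma>\<^sub>1 \<box> \<Sigma>\<^sub>2)"
    by (rule switchable_cart_prod[OF A1 A2 _ _ _ nu(2)]) (use mn in auto)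
  show "bdim (\<Sigma>\<^sub>1 \<box> \<Sigma>\<^sub>2) \<le> nubar ?N" by (rule bdim_le[OF nu(1) P])
  \<comment> \<open>\<open>P\<close> also guarantees that the minimum for the product is attained,
    so an optimal switching function exists to be restricted.\<close>
  have B: "1 \<le> bdim (\<Sigma>\<^sub>1 \<box> \<Sigma>\<^sub>2)" "switchable (bdim (\<Sigma>\<^sub>1 \<box> \<Sigma>\<^sub>2)) (\<Sigma>\<^sub>1 \<box> \<Sigma>\<^sub>2)"
    using bdim_switchable[OF nu(1) P] by auto
  \<comment> \<open>Positive orders give each factor a base vertex, through which a copy of the
    other factor passes.\<close>
  have "card (verts \<Sigma>\<^sub>1) \<noteq> 0" "card (verts \<Sigma>\<^sub>2) \<noteq> 0"
    using A1 A2 mn by (auto simp: antibalanced_complete_def)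
  then obtain u v where uv: "u \<in> verts \<Sigma>\<^sub>1" "v \<in> verts \<Sigma>\<^sub>2" by fastforce
  show "nubar m \<le> bdim (\<Sigma>\<^sub>1 \<box> \<Sigma>\<^sub>2)"
    using bdim_le[OF B(1) switchable_cart_prodD1[OF B(2) uv(2)]] nubar_eq_bdim[OF A1] by simp
  show "nubar n \<le> bdim (\<Sigma>\<^sub>1 \<box> \<Sigma>\<^sub>2)"
    using bdim_le[OF B(1) switchable_cart_prodD2[OF B(2) uv(1)]] nubar_eq_bdim[OF A2]
    by (simp add: antibalanced_complete_adj_iff[OF A2])
qed

theorem proposition2p6:
  fixes \<Sigma>\<^sub>1 :: "'a sgraph" and \<Sigma>\<^sub>2 :: "'b sgraph" and m n :: nat
  assumes "1 \<le> m" and "1 \<le> n"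
    and "antibalanced_complete m \<Sigma>\<^sub>1" and "antibalanced_complete n \<Sigma>\<^sub>2"
  shows "(n \<le> m \<longrightarrow> bdim (\<Sigma>\<^sub>1 \<box> \<Sigma>\<^sub>2) = nubar m) \<and> (m \<le> n \<longrightarrow> bdim (\<Sigma>\<^sub>1 \<box> \<Sigma>\<^sub>2) = nubar n)"
  using bdim_cart_prod_antibalanced_complete[OF assms]
  by (auto simp: max_def split: if_splits intro: antisym)

end
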